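(* Let $N\ge 2$ be an integer, let $p$ be a real number with $1<p<N$, let $\gamma\ge 0$, and let $$q>\frac{(N+\gamma)(p-1)}{N-p}.$$ Then there exists a nonnegative function $u\not\equiv 0$ on $\mathbb{R}^N$, $u\in W^{1,p}_{\rm loc}(\mathbb{R}^N)\cap C(\mathbb{R}^N)$, which is a weak solution of $$-\operatorname{div}\left(|\nabla u|^{p-2}\nabla u\right)\ge |x|^\gamma u^q\quad\text{in }\mathbb{R}^N.$$
   Context: A function $u\in W^{1,p}_{\rm loc}(\mathbb{R}^N)$ is a weak solution of $-\operatorname{div}(|\nabla u|^{p-2}\nabla u)\ge f$ in $\mathbb{R}^N$ if $$\int_{\mathbb{R}^N}|\nabla u|^{p-2}\nabla u\cdot\nabla\varphi\,dx\ \ge\ \int_{\mathbb{R}^N}f\varphi\,dx$$ for all $\varphi\in C_c^\infty(\mathbb{R}^N)$ with $\varphi\ge 0$. *)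

theory Defs
  imports "HOL-Analysis.Analysis"
begin

primrec Ck :: "nat \<Rightarrow> ('a::euclidean_space \<Rightarrow> real) \<Rightarrow> bool" where
  "Ck 0 f \<longleftrightarrow> continuous_on UNIV f"
| "Ck (Suc k) f \<longleftrightarrow> (\<forall>x. f differentiable (at x)) \<and>
     (\<forall>b\<in>Basis. Ck k (\<lambda>x. frechet_derivative f (at x) b))"

definition Cc_infinity :: "('a::euclidean_space \<Rightarrow> real) set" where
  "Cc_infinity = {\<phi>. (\<forall>k. Ck k \<phi>) \<and> compact (closure {x. \<phi> x \<noteq> 0})}"

definition grad :: "('a::euclidean_space \<Rightarrow> real) \<Rightarrow> 'a \<Rightarrow> 'a" where
  "grad \<phi> x = (\<Sum>b\<in>Basis. frechet_derivative \<phi> (at x) b *\<^sub>R b)"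

definition Lp_loc :: "real \<Rightarrow> ('a::euclidean_space \<Rightarrow> 'b::euclidean_space) set" where
  "Lp_loc p = {f \<in> borel_measurable lebesgue.
     \<forall>K. compact K \<longrightarrow> set_integrable lebesgue K (\<lambda>x. norm (f x) powr p)}"

definition has_weak_gradient :: "('a::euclidean_space \<Rightarrow> real) \<Rightarrow> ('a \<Rightarrow> 'a) \<Rightarrow> bool" where
  "has_weak_gradient u G \<longleftrightarrow> u \<in> Lp_loc 1 \<and> G \<in> Lp_loc 1 \<and>
     (\<forall>\<phi>\<in>Cc_infinity. \<forall>b\<in>Basis.
        (\<integral>x. u x * (grad \<phi> x \<bullet> b) \<partial>lebesgue) = - (\<integral>x. (G x \<bullet> b) * \<phi> x \<partial>lebesgue))"

definition W1p_loc :: "real \<Rightarrow> ('a::euclidean_space \<Rightarrow> real) set" where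
  "W1p_loc p = {u \<in> Lp_loc p. \<exists>G\<in>Lp_loc p. has_weak_gradient u G}"

(* The weak gradient G is unique up to null sets, so it does not matter which representative is
   chosen. For p > 1 the left integrand is automatically integrable since G is in L^p_loc; for the
   right one integrability is demanded, as the Bochner integral of a non-integrable function is 0.
   Where G x = 0 the left integrand is 0, also for p < 2. The inequality depends on f only up to null
   sets; in particular f x = norm x powr 0 is a faithful rendering of the weight 1, although
   0 powr 0 = 0 at the point x = 0. *)
definition p_laplace_weak_supersolution ::
    "real \<Rightarrow> ('a::euclidean_space \<Rightarrow> real) \<Rightarrow> ('a \<Rightarrow> real) \<Rightarrow> bool" where
  "p_laplace_weak_supersolution p f u \<longleftrightarrow> u \<in> W1p_loc p \<and>
     (\<exists>G\<in>Lp_loc p. has_weak_gradient u G \<and>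
       (\<forall>\<phi>\<in>Cc_infinity. (\<forall>x. \<phi> x \<ge> 0) \<longrightarrow>
          integrable lebesgue (\<lambda>x. f x * \<phi> x) \<and>
          (\<integral>x. (norm (G x) powr (p - 2) *\<^sub>R G x) \<bullet> grad \<phi> x \<partial>lebesgue)
            \<ge> (\<integral>x. f x * \<phi> x \<partial>lebesgue)))"

end

theory Submission
  imports Defs
begin

text \<open>
  The solution is explicit. With \<open>\<alpha> = p / (p - 1)\<close>, consider the radial function
  \<open>u x = \<epsilon> * (1 + norm x powr \<alpha>) powr (- s)\<close>. The exponent \<open>\<alpha>\<close> is the one for which the singular
  or degenerate powers of the norm cancel in the flux of the \<open>p\<close>-Laplacian:
  \<open>norm (\<nabla>u) powr (p - 2) *\<^sub>R \<nabla>u = (- c * (1 + norm x powr \<alpha>) powr (- m)) *\<^sub>R x\<close> with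
  \<open>m = (s + 1) * (p - 1)\<close> and \<open>c = (\<epsilon> * s * \<alpha>) powr (p - 1)\<close> (lemma \<open>p_flux_profile_grad\<close>).
  As \<open>\<alpha> > 1\<close>, both \<open>u\<close> and this flux are continuously differentiable on the whole space, the
  origin included, so everything can be computed classically, and the weak formulation follows by
  integration by parts against test functions (\<open>integration_by_parts_Cc_infinity\<close>,
  \<open>radial_flux_by_parts\<close>).

  Writing \<open>N\<close> for the dimension, minus the divergence of the flux is at least
  \<open>c * (N - (s + 1) * p) * (1 + norm x powr \<alpha>) powr (- m)\<close> (\<open>divergence_profile_ge\<close>), which is a
  positive multiple of that power if \<open>s < (N - p) / p\<close>. On the other side,
  \<open>norm x powr \<gamma> * u x powr q\<close> is at most
  \<open>\<epsilon> powr q * (1 + norm x powr \<alpha>) powr (\<gamma> / \<alpha> - s * q)\<close> (\<open>weighted_profile_le\<close>), and this power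
  decays at least as fast as the one above if
  \<open>s \<ge> (p - 1) * (p + \<gamma>) / (p * (q - p + 1))\<close>. The hypothesis on \<open>q\<close> says exactly that there
  is room for \<open>s\<close> between the two bounds (\<open>exponent_choice\<close>). It also gives \<open>q > p - 1\<close>, so the
  factor \<open>\<epsilon> powr q\<close> on the right is dominated by \<open>\<epsilon> powr (p - 1)\<close> on the left for small \<open>\<epsilon>\<close>.
\<close>

section \<open>Continuous functions and Lebesgue integrals\<close>

lemma borel_measurable_lebesgue_continuous:
  fixes f :: "'a::euclidean_space \<Rightarrow> 'b::euclidean_space"
  assumes "continuous_on UNIV f"
  shows "f \<in> borel_measurable lebesgue"
  using assms by (intro measurable_completion) (simp add: borel_measurable_continuous_onI)

lemma continuous_in_Lp_loc:
  fixes f :: "'a::euclidean_space \<Rightarrow> 'b::euclidean_space" and p :: real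
  assumes "continuous_on UNIV f" "p > 0"
  shows "f \<in> Lp_loc p"
proof -
  have c: "continuous_on UNIV (\<lambda>x. norm (f x) powr p)"
    using assms by (intro continuous_on_powr' continuous_intros) auto
  have "set_integrable lebesgue K (\<lambda>x. norm (f x) powr p)" if K: "compact K" for K
  proof -
    have i: "integrable lborel (\<lambda>x. indicator K x *\<^sub>R (norm (f x) powr p))"
      using K continuous_on_subset[OF c] by (intro borel_integrable_compact) auto
    then have "integrable lebesgue (\<lambda>x. indicator K x *\<^sub>R (norm (f x) powr p))"
      by (subst integrable_completion) (auto dest: borel_measurable_integrable)
    then show ?thesis unfolding set_integrable_def .
  qed
  then show ?thesis
    using borel_measurable_lebesgue_continuous[OF assms(1)] by (auto simp: Lp_loc_def)
qed

lemma integrable_continuous_bounded_support: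
  fixes f :: "'a::euclidean_space \<Rightarrow> real"
  assumes c: "continuous_on UNIV f" and R: "\<And>x. norm x > R \<Longrightarrow> f x = 0"
  shows "integrable lebesgue f"
proof -
  have "integrable lborel (\<lambda>x. indicator (cball 0 R) x *\<^sub>R f x)"
    using continuous_on_subset[OF c] by (intro borel_integrable_compact) auto
  also have "(\<lambda>x. indicator (cball 0 R) x *\<^sub>R f x) = f"
    using R by (auto simp: fun_eq_iff indicator_def not_le)
  finally show ?thesis
    by (subst integrable_completion) (auto dest: borel_measurable_integrable)
qed

lemma integral_lebesgue_translation:
  fixes f :: "'a::euclidean_space \<Rightarrow> real"
  assumes c: "continuous_on UNIV f"
  shows "(\<integral>x. f (x + a) \<partial>lebesgue) = (\<integral>x. f x \<partial>lebesgue)"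
proof -
  have m: "f \<in> borel_measurable borel"
    using c by (rule borel_measurable_continuous_onI)
  have "(\<integral>x. f x \<partial>lborel) = (\<integral>x. f x \<partial>distr lborel borel ((+) a))"
    by (simp add: lborel_distr_plus)
  also have "\<dots> = (\<integral>x. f (a + x) \<partial>lborel)"
    using m by (intro integral_distr) auto
  finally show ?thesis
    using m by (simp add: integral_completion add.commute)
qed

section \<open>Integration by parts on Euclidean space\<close>

lemma GDERIV_continuous_on:
  assumes "\<And>x. GDERIV f x :> F x"
  shows "continuous_on UNIV f"
  using assms unfolding gderiv_def
  by (meson continuous_at_imp_continuous_on has_derivative_continuous)

lemma GDERIV_along_line:
  assumes "GDERIV f (x + t *\<^sub>R b) :> D"
  shows "((\<lambda>t. f (x + t *\<^sub>R b)) has_real_derivative (D \<bullet> b)) (at t)"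
proof -
  have "((\<lambda>t. x + t *\<^sub>R b) has_derivative (\<lambda>s. s *\<^sub>R b)) (at t)"
    by (auto intro!: derivative_eq_intros)
  from has_derivative_compose[OF this assms[unfolded gderiv_def]]
  have "((\<lambda>t. f (x + t *\<^sub>R b)) has_derivative (\<lambda>s. s *\<^sub>R b \<bullet> D)) (at t)" .
  then show ?thesis
    by (simp add: has_field_derivative_def inner_commute mult_commute_abs)
qed

text \<open>
  By translation invariance, the difference quotients of \<open>h\<close> in the direction \<open>b\<close> have integral
  \<open>0\<close>. The mean value theorem bounds them, for steps of length at most \<open>1\<close>, by a constant times the
  indicator of a fixed ball, so by dominated convergence their limit has integral \<open>0\<close> as well. This
  avoids Fubini's theorem and the choice of coordinates.
\<close>

lemma integral_gradient_eq_0: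
  fixes h :: "'a::euclidean_space \<Rightarrow> real"
  assumes H: "\<And>x. GDERIV h x :> H x"
    and cH: "continuous_on UNIV H"
    and R: "\<And>x. norm x > R \<Longrightarrow> h x = 0"
  shows "(\<integral>x. H x \<bullet> b \<partial>lebesgue) = 0"
proof -
  define t :: "nat \<Rightarrow> real" where "t n = inverse (real (Suc n))" for n
  have t: "t n > 0" "t n \<le> 1" for n by (auto simp: t_def divide_simps)
  have tn: "norm (s *\<^sub>R b) \<le> norm b" if "0 \<le> s" "s \<le> 1" for s
    using that by (simp add: mult_left_le_one_le)
  define D where "D n x = (h (x + t n *\<^sub>R b) - h x) / t n" for n x
  have ch: "continuous_on UNIV h" by (rule GDERIV_continuous_on[OF H])
  have ch': "continuous_on UNIV (\<lambda>x. h (x + a))" for a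
    by (intro continuous_on_compose2[OF ch] continuous_intros) auto
  have "bounded (H ` cball 0 (R + 2 * norm b))"
    by (intro compact_imp_bounded compact_continuous_image continuous_on_subset[OF cH]) auto
  then obtain M where M: "\<And>x. norm x \<le> R + 2 * norm b \<Longrightarrow> norm (H x) \<le> M"
    by (force simp: bounded_iff)
  have bound: "norm (D n x) \<le> indicator (cball 0 (R + norm b)) x * (M * norm b)" for n x
  proof (cases "norm x \<le> R + norm b")
    case True
    obtain z where z: "z > 0" "z < t n"
      "h (x + t n *\<^sub>R b) - h (x + 0 *\<^sub>R b) = (t n - 0) * (H (x + z *\<^sub>R b) \<bullet> b)"
      using MVT2[OF t(1)[of n], of "\<lambda>s. h (x + s *\<^sub>R b)" "\<lambda>s. H (x + s *\<^sub>R b) \<bullet> b"]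
        GDERIV_along_line[OF H] by blast
    have "norm (D n x) = \<bar>H (x + z *\<^sub>R b) \<bullet> b\<bar>"
      using z(3) t(1)[of n] by (simp add: D_def)
    also have "\<dots> \<le> norm (H (x + z *\<^sub>R b)) * norm b"
      by (rule Cauchy_Schwarz_ineq2)
    also have "\<dots> \<le> M * norm b"
    proof (intro mult_right_mono M)
      show "norm (x + z *\<^sub>R b) \<le> R + 2 * norm b"
        using True tn[of z] z t(2)[of n] norm_triangle_ineq[of x "z *\<^sub>R b"] by linarith
    qed auto
    finally show ?thesis using True by simp
  next
    case False
    have "norm x \<le> norm (x + t n *\<^sub>R b) + norm (t n *\<^sub>R b)"
      using norm_triangle_ineq4[of "x + t n *\<^sub>R b" "t n *\<^sub>R b"] by simp
    then have "norm (x + t n *\<^sub>R b) > R"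
      using False tn[of "t n"] t[of n] by linarith
    moreover have "norm x > R" using False norm_ge_zero[of b] by linarith
    ultimately show ?thesis by (simp add: D_def R False)
  qed
  have lim: "(\<lambda>n. D n x) \<longlonglongrightarrow> H x \<bullet> b" for x
  proof -
    have "((\<lambda>s. h (x + s *\<^sub>R b)) has_real_derivative (H x \<bullet> b)) (at 0)"
      by (rule GDERIV_along_line) (simp add: H)
    then have "((\<lambda>s. (h (x + s *\<^sub>R b) - h x) / s) \<longlongrightarrow> H x \<bullet> b) (at 0)"
      by (simp add: DERIV_def)
    moreover have "filterlim t (at 0) sequentially"
      unfolding filterlim_at t_def using LIMSEQ_inverse_real_of_nat by auto
    ultimately show ?thesis
      unfolding D_def by (rule filterlim_compose)
  qed
  have int_h: "integrable lebesgue h"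
    by (rule integrable_continuous_bounded_support[OF ch R])
  have int_h': "integrable lebesgue (\<lambda>x. h (x + t n *\<^sub>R b))" for n
  proof (rule integrable_continuous_bounded_support[OF ch'])
    fix x :: 'a assume "norm x > R + norm b"
    then have "norm (x + t n *\<^sub>R b) > R"
      using norm_triangle_ineq4[of "x + t n *\<^sub>R b" "t n *\<^sub>R b"] tn[of "t n"] t[of n] by simp
    then show "h (x + t n *\<^sub>R b) = 0" by (rule R)
  qed
  have "(\<integral>x. D n x \<partial>lebesgue) = 0" for n
    using int_h int_h' integral_lebesgue_translation[OF ch, of "t n *\<^sub>R b"] by (simp add: D_def)
  moreover have "(\<lambda>n. \<integral>x. D n x \<partial>lebesgue) \<longlonglongrightarrow> (\<integral>x. H x \<bullet> b \<partial>lebesgue)"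
  proof (rule integral_dominated_convergence)
    show "(\<lambda>x. H x \<bullet> b) \<in> borel_measurable lebesgue"
      by (intro borel_measurable_lebesgue_continuous continuous_intros cH)
    show "D n \<in> borel_measurable lebesgue" for n
      unfolding D_def using t[of n]
      by (intro borel_measurable_lebesgue_continuous continuous_intros ch ch') auto
    have "integrable lborel (\<lambda>x. indicator (cball 0 (R + norm b)) x *\<^sub>R (M * norm b))"
      by (intro borel_integrable_compact) auto
    then show "integrable lebesgue (\<lambda>x. indicator (cball 0 (R + norm b)) x * (M * norm b))"
      by (subst integrable_completion) (auto dest: borel_measurable_integrable)
  qed (use lim bound in auto)
  ultimately show ?thesis
    by (simp add: LIMSEQ_const_iff)
qed

lemma GDERIV_grad:
  assumes "\<phi> \<in> Cc_infinity"
  shows "GDERIV \<phi> x :> grad \<phi> x"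
proof -
  let ?D = "frechet_derivative \<phi> (at x)"
  have "Ck (Suc 0) \<phi>" using assms unfolding Cc_infinity_def by blast
  then have D: "(\<phi> has_derivative ?D) (at x)" by (simp add: frechet_derivative_works)
  have lin: "linear ?D" using D by (rule has_derivative_linear)
  have "?D h = h \<bullet> grad \<phi> x" for h
  proof -
    have "?D h = ?D (\<Sum>b\<in>Basis. (h \<bullet> b) *\<^sub>R b)" by (simp add: euclidean_representation)
    also have "\<dots> = h \<bullet> grad \<phi> x"
      by (simp add: linear_sum[OF lin] linear_scale[OF lin] grad_def inner_sum_right mult.commute)
    finally show ?thesis .
  qed
  then have "?D = (\<lambda>h. h \<bullet> grad \<phi> x)" by auto
  then show ?thesis using D unfolding gderiv_def by metis
qed

lemma continuous_on_grad:
  assumes "\<phi> \<in> Cc_infinity"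
  shows "continuous_on UNIV (grad \<phi>)"
proof -
  have "Ck (Suc 0) \<phi>" using assms unfolding Cc_infinity_def by blast
  then show ?thesis unfolding grad_def by (auto intro!: continuous_intros)
qed

lemma Cc_infinity_bounded_support:
  assumes "\<phi> \<in> Cc_infinity"
  obtains R where "\<And>x. norm x > R \<Longrightarrow> \<phi> x = 0" "\<And>x. norm x > R \<Longrightarrow> grad \<phi> x = 0"
proof -
  have "bounded (closure {x. \<phi> x \<noteq> 0})"
    using assms compact_imp_bounded unfolding Cc_infinity_def by blast
  then obtain R where R: "\<And>x. x \<in> closure {x. \<phi> x \<noteq> 0} \<Longrightarrow> norm x \<le> R"
    unfolding bounded_iff by blast
  have z: "\<phi> x = 0" if "norm x > R" for x
    using R[of x] closure_subset[of "{x. \<phi> x \<noteq> 0}"] that by fastforce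
  have "grad \<phi> x = 0" if x: "norm x > R" for x
  proof -
    have op: "open {y::'a. norm y > R}" by (intro open_Collect_less continuous_intros)
    have "((\<lambda>_. 0) has_derivative (\<lambda>h. h \<bullet> grad \<phi> x)) (at x)"
      using has_derivative_transform_within_open[OF GDERIV_grad[OF assms, unfolded gderiv_def] op, of x "\<lambda>_. 0"]
        z x by auto
    then have "(\<lambda>h. h \<bullet> grad \<phi> x) = (\<lambda>h. 0)"
      by (rule has_derivative_unique) simp
    then have "grad \<phi> x \<bullet> grad \<phi> x = 0" by metis
    then show ?thesis by simp
  qed
  with z show ?thesis using that by blast
qed

text \<open>
  The product \<open>g * \<phi>\<close> has compact support, so the integral of its directional derivative vanishes.
\<close>

lemma integration_by_parts_Cc_infinity:
  fixes g :: "'a::euclidean_space \<Rightarrow> real"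
  assumes G: "\<And>x. GDERIV g x :> G x" and cG: "continuous_on UNIV G" and \<phi>: "\<phi> \<in> Cc_infinity"
  shows "(\<integral>x. g x * (grad \<phi> x \<bullet> b) \<partial>lebesgue) = - (\<integral>x. (G x \<bullet> b) * \<phi> x \<partial>lebesgue)"
    and "integrable lebesgue (\<lambda>x. g x * (grad \<phi> x \<bullet> b))"
    and "integrable lebesgue (\<lambda>x. (G x \<bullet> b) * \<phi> x)"
proof -
  note D\<phi> = GDERIV_grad[OF \<phi>]
  have c: "continuous_on UNIV g" "continuous_on UNIV \<phi>" "continuous_on UNIV (grad \<phi>)"
    by (fact GDERIV_continuous_on[OF G] GDERIV_continuous_on[OF D\<phi>] continuous_on_grad[OF \<phi>])+
  obtain R where R: "\<And>x. norm x > R \<Longrightarrow> \<phi> x = 0" "\<And>x. norm x > R \<Longrightarrow> grad \<phi> x = 0"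
    using Cc_infinity_bounded_support[OF \<phi>] by blast
  show 1: "integrable lebesgue (\<lambda>x. g x * (grad \<phi> x \<bullet> b))"
    by (rule integrable_continuous_bounded_support[where R = R])
      (auto intro!: continuous_intros c simp: R)
  show 2: "integrable lebesgue (\<lambda>x. (G x \<bullet> b) * \<phi> x)"
    by (rule integrable_continuous_bounded_support[where R = R])
      (auto intro!: continuous_intros c cG simp: R)
  have "(\<integral>x. (g x *\<^sub>R grad \<phi> x + \<phi> x *\<^sub>R G x) \<bullet> b \<partial>lebesgue) = 0"
    by (rule integral_gradient_eq_0[where R = R and h = "\<lambda>x. g x * \<phi> x"])
      (auto intro!: continuous_intros GDERIV_mult G D\<phi> c cG simp: R)
  also have "(\<lambda>x. (g x *\<^sub>R grad \<phi> x + \<phi> x *\<^sub>R G x) \<bullet> b)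
      = (\<lambda>x. g x * (grad \<phi> x \<bullet> b) + (G x \<bullet> b) * \<phi> x)"
    by (auto simp: fun_eq_iff inner_add_left)
  finally show "(\<integral>x. g x * (grad \<phi> x \<bullet> b) \<partial>lebesgue) = - (\<integral>x. (G x \<bullet> b) * \<phi> x \<partial>lebesgue)"
    using Bochner_Integration.integral_add[OF 1 2] by linarith
qed

section \<open>Weak gradients and radial vector fields\<close>

lemma C1_in_W1p_loc:
  fixes u :: "'a::euclidean_space \<Rightarrow> real"
  assumes G: "\<And>x. GDERIV u x :> G x" and cG: "continuous_on UNIV G" and "(p::real) > 0"
  shows "has_weak_gradient u G" "G \<in> Lp_loc p" "u \<in> W1p_loc p"
proof -
  have cu: "continuous_on UNIV u" by (rule GDERIV_continuous_on[OF G])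
  show 1: "has_weak_gradient u G"
    unfolding has_weak_gradient_def
    using integration_by_parts_Cc_infinity(1)[OF G cG] continuous_in_Lp_loc[OF cu] continuous_in_Lp_loc[OF cG]
    by auto
  show "G \<in> Lp_loc p" "u \<in> W1p_loc p"
    using 1 continuous_in_Lp_loc[OF cu \<open>p > 0\<close>] continuous_in_Lp_loc[OF cG \<open>p > 0\<close>]
    by (auto simp: W1p_loc_def)
qed

text \<open>
  Integration by parts in every coordinate, applied to the components of the field
  \<open>w x *\<^sub>R x\<close>, whose divergence is \<open>DIM('a) * w x + W x \<bullet> x\<close>.
\<close>

lemma radial_flux_by_parts:
  fixes w :: "'a::euclidean_space \<Rightarrow> real"
  assumes W: "\<And>x. GDERIV w x :> W x" and cW: "continuous_on UNIV W" and \<phi>: "\<phi> \<in> Cc_infinity"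
  shows "(\<integral>x. (w x *\<^sub>R x) \<bullet> grad \<phi> x \<partial>lebesgue)
           = - (\<integral>x. (DIM('a) * w x + W x \<bullet> x) * \<phi> x \<partial>lebesgue)"
    and "integrable lebesgue (\<lambda>x. (DIM('a) * w x + W x \<bullet> x) * \<phi> x)"
proof -
  define G where "G b x = w x *\<^sub>R b + (x \<bullet> b) *\<^sub>R W x" for b x :: 'a
  have G: "GDERIV (\<lambda>x. w x * (x \<bullet> b)) x :> G b x" for b x
  proof -
    have "GDERIV (\<lambda>x. x \<bullet> b) x :> b"
      unfolding gderiv_def by (auto intro!: derivative_eq_intros)
    from GDERIV_mult[OF W this] show ?thesis by (simp add: G_def)
  qed
  have cG: "continuous_on UNIV (G b)" for b
    unfolding G_def by (intro continuous_intros cW GDERIV_continuous_on[OF W])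
  note ibp = integration_by_parts_Cc_infinity[OF G cG \<phi>]
  have L: "(w x *\<^sub>R x) \<bullet> grad \<phi> x = (\<Sum>b\<in>Basis. w x * (x \<bullet> b) * (grad \<phi> x \<bullet> b))" for x
    by (subst euclidean_inner) (simp add: mult.assoc)
  have R: "(DIM('a) * w x + W x \<bullet> x) * \<phi> x = (\<Sum>b\<in>Basis. (G b x \<bullet> b) * \<phi> x)" for x
  proof -
    have "(\<Sum>b\<in>Basis. G b x \<bullet> b) = DIM('a) * w x + W x \<bullet> x"
      by (subst euclidean_inner) (simp add: G_def inner_add_left sum.distrib mult.commute)
    then show ?thesis by (simp add: sum_distrib_right[symmetric])
  qed
  show "integrable lebesgue (\<lambda>x. (DIM('a) * w x + W x \<bullet> x) * \<phi> x)"
    unfolding R by (intro Bochner_Integration.integrable_sum ibp)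
  show "(\<integral>x. (w x *\<^sub>R x) \<bullet> grad \<phi> x \<partial>lebesgue)
           = - (\<integral>x. (DIM('a) * w x + W x \<bullet> x) * \<phi> x \<partial>lebesgue)"
    unfolding L R using ibp
    by (simp add: Bochner_Integration.integral_sum sum_negf)
qed

section \<open>The radial profile\<close>

text \<open>
  At the origin, where the norm is not differentiable, the power still is: it is
  \<open>o(norm y)\<close> because \<open>\<alpha> > 1\<close>. The formula gives the correct gradient \<open>0\<close> there.
\<close>

lemma GDERIV_norm_powr:
  fixes x :: "'a::euclidean_space" and \<alpha> :: real
  assumes "\<alpha> > 1"
  shows "GDERIV (\<lambda>x. norm x powr \<alpha>) x :> (\<alpha> * norm x powr (\<alpha> - 2)) *\<^sub>R x"
proof (cases "x = 0")
  case False
  have "((\<lambda>r. r powr \<alpha>) has_real_derivative \<alpha> * norm x powr (\<alpha> - 1)) (at (norm x))"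
    using False by (intro has_real_derivative_powr) auto
  then have "GDERIV (\<lambda>x. norm x powr \<alpha>) x :> (\<alpha> * norm x powr (\<alpha> - 1)) *\<^sub>R sgn x"
    using GDERIV_norm[OF False] by (intro GDERIV_DERIV_compose)
  moreover have "norm x powr (\<alpha> - 1) / norm x = norm x powr (\<alpha> - 2)"
    using False powr_diff[of "norm x" "\<alpha> - 1" 1] by simp
  ultimately show ?thesis by (simp add: sgn_div_norm divide_inverse mult.assoc)
next
  case True
  have "((\<lambda>y::'a. norm (norm y powr \<alpha>) / norm y) \<longlongrightarrow> 0) (at 0)"
  proof (rule Lim_transform_eventually)
    have "((\<lambda>y::'a. norm y powr (\<alpha> - 1)) \<longlongrightarrow> norm (0::'a) powr (\<alpha> - 1)) (at 0)"
      using assms by (intro tendsto_intros) auto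
    then show "((\<lambda>y::'a. norm y powr (\<alpha> - 1)) \<longlongrightarrow> 0) (at 0)" by simp
    show "\<forall>\<^sub>F y::'a in at 0. norm y powr (\<alpha> - 1) = norm (norm y powr \<alpha>) / norm y"
      by (auto simp: eventually_at powr_diff intro!: exI[of _ 1])
  qed
  then show ?thesis
    using True assms unfolding gderiv_def has_derivative_iff_norm by simp
qed

text \<open>
  The scalar factor may be unbounded near the origin, but the norm of the product is
  \<open>norm x powr (\<alpha> - 1)\<close>, which tends to \<open>0\<close>.
\<close>

lemma continuous_on_norm_powr_scaleR:
  fixes \<alpha> :: real
  assumes "\<alpha> > 1"
  shows "continuous_on UNIV (\<lambda>x::'a::euclidean_space. norm x powr (\<alpha> - 2) *\<^sub>R x)"
proof -
  have "isCont (\<lambda>x::'a. norm x powr (\<alpha> - 2) *\<^sub>R x) x" for x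
  proof (cases "x = 0")
    case False
    then show ?thesis by (intro continuous_intros) auto
  next
    case True
    have n: "norm (norm y powr (\<alpha> - 2) *\<^sub>R y) = norm y powr (\<alpha> - 1)" for y :: 'a
      using powr_add[of "norm y" "\<alpha> - 2" 1] by (cases "y = 0") auto
    have "((\<lambda>y::'a. norm y powr (\<alpha> - 1)) \<longlongrightarrow> norm (0::'a) powr (\<alpha> - 1)) (at 0)"
      using assms by (intro tendsto_intros) auto
    then have "((\<lambda>y::'a. norm y powr (\<alpha> - 2) *\<^sub>R y) \<longlongrightarrow> 0) (at 0)"
      by (subst tendsto_norm_zero_iff[symmetric]) (simp only: n, simp)
    then show ?thesis using True by (simp add: isCont_def)
  qed
  then show ?thesis by (simp add: continuous_on_eq_continuous_at)
qed

definition profile :: "real \<Rightarrow> real \<Rightarrow> 'a::euclidean_space \<Rightarrow> real" where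
  "profile \<alpha> m x = (1 + norm x powr \<alpha>) powr m"

definition profile_grad :: "real \<Rightarrow> real \<Rightarrow> 'a::euclidean_space \<Rightarrow> 'a" where
  "profile_grad \<alpha> m x = (m * \<alpha> * profile \<alpha> (m - 1) x * norm x powr (\<alpha> - 2)) *\<^sub>R x"

lemma profile_pos: "profile \<alpha> m x > 0"
proof -
  have "1 + norm x powr \<alpha> > 0" by (simp add: add_pos_nonneg)
  then show ?thesis by (simp add: profile_def)
qed

lemma GDERIV_profile:
  fixes \<alpha> :: real
  assumes "\<alpha> > 1"
  shows "GDERIV (profile \<alpha> m) x :> profile_grad \<alpha> m x"
proof -
  have "1 + norm x powr \<alpha> > 0" by (simp add: add_pos_nonneg)
  then have "((\<lambda>r. (1 + r) powr m) has_real_derivative m * (1 + norm x powr \<alpha>) powr (m - 1))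
      (at (norm x powr \<alpha>))"
    by (auto intro!: derivative_eq_intros)
  from GDERIV_DERIV_compose[OF GDERIV_norm_powr[OF assms] this]
  show ?thesis by (simp add: profile_def[abs_def] profile_grad_def mult_ac)
qed

lemma continuous_on_profile:
  fixes \<alpha> :: real
  assumes "\<alpha> > 1"
  shows "continuous_on UNIV (profile \<alpha> m)"
  by (rule GDERIV_continuous_on[OF GDERIV_profile[OF assms]])

lemma continuous_on_profile_grad:
  fixes \<alpha> :: real
  assumes "\<alpha> > 1"
  shows "continuous_on UNIV (profile_grad \<alpha> m)"
proof -
  have "continuous_on UNIV (\<lambda>x::'a. (m * \<alpha> * profile \<alpha> (m - 1) x) *\<^sub>R (norm x powr (\<alpha> - 2) *\<^sub>R x))"
    by (intro continuous_intros continuous_on_profile continuous_on_norm_powr_scaleR assms)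
  then show ?thesis by (simp add: profile_grad_def[abs_def])
qed

section \<open>The flux and the nonlinear right-hand side\<close>

text \<open>
  The gradient of the profile carries a factor \<open>norm x powr (\<alpha> - 2)\<close> in front of \<open>x\<close>. In the flux
  it turns into \<open>norm x powr ((\<alpha> - 2) * (p - 1) + (p - 2))\<close>, and the choice of \<open>\<alpha>\<close> makes this
  exponent zero. At the origin both sides vanish.
\<close>

lemma p_flux_profile_grad:
  fixes x :: "'a::euclidean_space"
  assumes p: "p > 1" and \<alpha>: "\<alpha> = p / (p - 1)" and s: "s > 0" and \<epsilon>: "\<epsilon> > 0"
  defines "g \<equiv> \<epsilon> *\<^sub>R profile_grad \<alpha> (- s) x"
  shows "norm g powr (p - 2) *\<^sub>R g
     = - ((\<epsilon> * s * \<alpha>) powr (p - 1) * profile \<alpha> (- ((s + 1) * (p - 1))) x) *\<^sub>R x"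
proof (cases "x = 0")
  case True
  then show ?thesis by (simp add: g_def profile_grad_def)
next
  case False
  define r where "r = norm x"
  define B where "B = 1 + r powr \<alpha>"
  have r: "r > 0" using False by (simp add: r_def)
  have B: "B > 0" by (simp add: B_def add_pos_nonneg)
  have \<alpha>1: "\<alpha> > 1" using p by (simp add: \<alpha>)
  define c where "c = \<epsilon> * s * \<alpha>"
  have c: "c > 0" using \<alpha>1 s \<epsilon> by (simp add: c_def)
  define a where "a = c * B powr (- s - 1) * r powr (\<alpha> - 2)"
  have a: "a > 0" using c B r by (simp add: a_def)
  have g: "g = - (a *\<^sub>R x)"
    by (simp add: g_def profile_grad_def profile_def a_def c_def B_def r_def mult_ac)
  have e: "(\<alpha> - 2) * (p - 1) + (p - 2) = 0"
    using p by (simp add: \<alpha> field_simps)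
  have "norm g powr (p - 2) * a = (a * r) powr (p - 2) * a"
    using a by (simp add: g r_def)
  also have "\<dots> = a powr (p - 1) * r powr (p - 2)"
    using a r powr_add[of a "p - 2" 1] by (simp add: powr_mult)
  also have "\<dots> = c powr (p - 1) * B powr ((- s - 1) * (p - 1)) *
      (r powr ((\<alpha> - 2) * (p - 1)) * r powr (p - 2))"
    using c B r by (simp add: a_def powr_mult powr_powr)
  also have "r powr ((\<alpha> - 2) * (p - 1)) * r powr (p - 2) = 1"
    using r by (simp add: powr_add[symmetric] e)
  also have "(- s - 1) * (p - 1) = - ((s + 1) * (p - 1))" by (simp add: algebra_simps)
  finally have "norm g powr (p - 2) * a = c powr (p - 1) * profile \<alpha> (- ((s + 1) * (p - 1))) x"
    by (simp add: profile_def B_def r_def)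
  moreover have "norm g powr (p - 2) *\<^sub>R g = - (norm g powr (p - 2) * a) *\<^sub>R x"
    by (subst (2) g) simp
  ultimately show ?thesis by (simp add: c_def)
qed

text \<open>
  The gradient term equals \<open>- m * \<alpha> * profile \<alpha> (- m) x\<close> times
  \<open>norm x powr \<alpha> / (1 + norm x powr \<alpha>)\<close>, and this quotient is at most \<open>1\<close>.
\<close>

lemma divergence_profile_ge:
  fixes x :: "'a::euclidean_space" and \<alpha> m :: real
  assumes "\<alpha> > 1" "m \<ge> 0"
  shows "DIM('a) * profile \<alpha> (- m) x + profile_grad \<alpha> (- m) x \<bullet> x
           \<ge> (DIM('a) - m * \<alpha>) * profile \<alpha> (- m) x"
proof -
  define B where "B = 1 + norm x powr \<alpha>"
  have B: "B > 0" by (simp add: B_def add_pos_nonneg)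
  have "norm x powr (\<alpha> - 2) * (x \<bullet> x) = norm x powr \<alpha>"
    using powr_add[of "norm x" "\<alpha> - 2" 2] by (cases "x = 0") (auto simp: dot_square_norm)
  then have "profile_grad \<alpha> (- m) x \<bullet> x = - (m * \<alpha> * (profile \<alpha> (- m - 1) x * norm x powr \<alpha>))"
    by (simp add: profile_grad_def mult.assoc)
  moreover have "profile \<alpha> (- m - 1) x * norm x powr \<alpha> \<le> profile \<alpha> (- m) x"
  proof -
    have "profile \<alpha> (- m - 1) x * norm x powr \<alpha> \<le> profile \<alpha> (- m - 1) x * B"
      using profile_pos[of \<alpha> "- m - 1" x] by (intro mult_left_mono) (auto simp: B_def)
    also have "\<dots> = profile \<alpha> (- m) x"
      using B powr_add[of B "- m - 1" 1] by (simp add: profile_def B_def)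
    finally show ?thesis .
  qed
  then have "m * \<alpha> * (profile \<alpha> (- m - 1) x * norm x powr \<alpha>) \<le> m * \<alpha> * profile \<alpha> (- m) x"
    using assms by (intro mult_left_mono) auto
  ultimately show ?thesis by (simp add: algebra_simps)
qed

text \<open>
  The two conditions on \<open>s\<close> amount to
  \<open>(p - 1) * (p + \<gamma>) / (p * (q - p + 1)) \<le> s < (N - p) / p\<close>. After clearing denominators, the
  lower bound is below the upper one if and only if \<open>q * (N - p) > (N + \<gamma>) * (p - 1)\<close>.
\<close>

lemma exponent_choice:
  fixes N p q \<gamma> :: real
  assumes p: "1 < p" "p < N" and \<gamma>: "\<gamma> \<ge> 0" and q: "q > (N + \<gamma>) * (p - 1) / (N - p)"
  obtains s where "s > 0" "(s + 1) * p < N" "q > p - 1"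
    "\<gamma> * (p - 1) / p - s * q \<le> - ((s + 1) * (p - 1))"
proof -
  have q1: "q * (N - p) > (N + \<gamma>) * (p - 1)"
    using q p by (simp add: divide_less_eq)
  have "(p - 1) * (N - p) < q * (N - p)"
  proof -
    have "(p - 1) * (N - p) \<le> (p - 1) * (N + \<gamma>)"
      using p \<gamma> by (intro mult_left_mono) auto
    then show ?thesis using q1 by (simp add: mult.commute)
  qed
  then have qp: "q > p - 1" using p by simp
  have "(p - 1) * (p + \<gamma>) / (p * (q - p + 1)) < (N - p) / p"
  proof -
    have "(p - 1) * (p + \<gamma>) < (N - p) * (q - p + 1)"
      using q1 by (simp add: algebra_simps)
    then have "(p - 1) * (p + \<gamma>) / (p * (q - p + 1)) < (N - p) * (q - p + 1) / (p * (q - p + 1))"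
      using p qp by (intro divide_strict_right_mono) auto
    then show ?thesis using qp by simp
  qed
  then obtain s where s: "(p - 1) * (p + \<gamma>) / (p * (q - p + 1)) < s" "s < (N - p) / p"
    using dense by blast
  have "0 < (p - 1) * (p + \<gamma>) / (p * (q - p + 1))"
    using p qp \<gamma> by (intro divide_pos_pos mult_pos_pos) auto
  with s have s0: "s > 0" by linarith
  have "(s + 1) * p < N" using s p by (simp add: less_divide_eq algebra_simps)
  moreover have "(p - 1) * (p + \<gamma>) < s * (p * (q - p + 1))"
    using s(1) p qp by (simp add: divide_less_eq)
  then have "\<gamma> * (p - 1) / p - s * q \<le> - ((s + 1) * (p - 1))"
    using p by (simp add: field_simps)
  ultimately show ?thesis using that s0 qp by blast
qed

text \<open>
  The weight \<open>norm x powr \<gamma>\<close> is absorbed into the profile, being at most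
  \<open>(1 + norm x powr \<alpha>) powr (\<gamma> / \<alpha>)\<close>.
\<close>

lemma weighted_profile_le:
  fixes \<alpha> \<gamma> \<epsilon> s q m :: real
  assumes "\<alpha> > 1" "\<gamma> \<ge> 0" "\<epsilon> > 0" and e: "\<gamma> / \<alpha> - s * q \<le> - m"
  shows "norm x powr \<gamma> * (\<epsilon> * profile \<alpha> (- s) x) powr q \<le> \<epsilon> powr q * profile \<alpha> (- m) x"
proof -
  define B where "B = 1 + norm x powr \<alpha>"
  have B: "B \<ge> 1" by (simp add: B_def)
  have "norm x powr \<gamma> \<le> B powr (\<gamma> / \<alpha>)"
  proof (cases "x = 0")
    case False
    have "norm x powr \<gamma> = (norm x powr \<alpha>) powr (\<gamma> / \<alpha>)"
      using assms by (simp add: powr_powr)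
    also have "\<dots> \<le> B powr (\<gamma> / \<alpha>)"
      using assms by (intro powr_mono2) (auto simp: B_def)
    finally show ?thesis .
  qed auto
  then have "norm x powr \<gamma> * B powr (- s * q) \<le> B powr (\<gamma> / \<alpha>) * B powr (- s * q)"
    by (intro mult_right_mono) auto
  also have "\<dots> = B powr (\<gamma> / \<alpha> - s * q)" by (simp add: powr_add[symmetric])
  also have "\<dots> \<le> B powr (- m)" using e B by (intro powr_mono) auto
  finally have "\<epsilon> powr q * (norm x powr \<gamma> * B powr (- s * q)) \<le> \<epsilon> powr q * B powr (- m)"
    by (intro mult_left_mono) auto
  moreover have "(\<epsilon> * profile \<alpha> (- s) x) powr q = \<epsilon> powr q * B powr (- s * q)"
    using assms B by (simp add: profile_def B_def powr_mult powr_powr)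
  ultimately show ?thesis by (simp add: profile_def B_def mult_ac)
qed

section \<open>Existence of a positive supersolution\<close>

lemma supersolution_exists:
  fixes p q \<gamma> :: real
  assumes p: "1 < p" "p < real DIM('a::euclidean_space)" and \<gamma>: "\<gamma> \<ge> 0"
    and q: "q > (real DIM('a) + \<gamma>) * (p - 1) / (real DIM('a) - p)"
  shows "\<exists>u :: 'a \<Rightarrow> real.
    (\<forall>x. u x > 0) \<and> u \<in> W1p_loc p \<and> continuous_on UNIV u \<and>
    p_laplace_weak_supersolution p (\<lambda>x. norm x powr \<gamma> * u x powr q) u"
proof -
  obtain s where s: "s > 0" "(s + 1) * p < real DIM('a)" and qp: "q > p - 1"
    and e: "\<gamma> * (p - 1) / p - s * q \<le> - ((s + 1) * (p - 1))"
    using exponent_choice[OF p \<gamma> q] .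
  define \<alpha> where "\<alpha> = p / (p - 1)"
  have \<alpha>: "\<alpha> > 1" using p by (simp add: \<alpha>_def)
  \<comment> \<open>decay exponent of the flux and of its divergence\<close>
  define m where "m = (s + 1) * (p - 1)"
  have m: "m \<ge> 0" "m * \<alpha> = (s + 1) * p" using p s by (auto simp: m_def \<alpha>_def)
  define \<delta> where "\<delta> = DIM('a) - m * \<alpha>"
  have \<delta>: "\<delta> > 0" using s m by (simp add: \<delta>_def)
  \<comment> \<open>\<open>\<epsilon>\<close> solves \<open>\<epsilon> powr q = (\<epsilon> * s * \<alpha>) powr (p - 1) * \<delta>\<close>, so that the constants on the two
    sides of the inequality agree\<close>
  define K where "K = (s * \<alpha>) powr (p - 1) * \<delta>"
  have K: "K > 0" using s \<alpha> \<delta> by (simp add: K_def)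
  define \<epsilon> where "\<epsilon> = K powr (1 / (q - p + 1))"
  have \<epsilon>: "\<epsilon> > 0" using K by (simp add: \<epsilon>_def)
  define c where "c = (\<epsilon> * s * \<alpha>) powr (p - 1)"
  have c: "c > 0" using \<epsilon> s \<alpha> by (simp add: c_def)
  have \<epsilon>q: "\<epsilon> powr q = c * \<delta>"
  proof -
    have "\<epsilon> powr q = \<epsilon> powr (p - 1) * \<epsilon> powr (q - p + 1)"
      by (simp add: powr_add[symmetric])
    also have "\<epsilon> powr (q - p + 1) = K"
      using K qp by (simp add: \<epsilon>_def powr_powr)
    finally show ?thesis
      using \<epsilon> s \<alpha> by (simp add: K_def c_def powr_mult mult.assoc)
  qed

  define u :: "'a \<Rightarrow> real" where "u x = \<epsilon> * profile \<alpha> (- s) x" for x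
  define G :: "'a \<Rightarrow> 'a" where "G x = \<epsilon> *\<^sub>R profile_grad \<alpha> (- s) x" for x
  have G: "GDERIV u x :> G x" for x
    unfolding u_def G_def
    by (rule GDERIV_DERIV_compose[OF GDERIV_profile[OF \<alpha>]]) (auto intro!: derivative_eq_intros)
  have cG: "continuous_on UNIV G"
    unfolding G_def by (intro continuous_intros continuous_on_profile_grad \<alpha>)
  have cu: "continuous_on UNIV u" by (rule GDERIV_continuous_on[OF G])
  have W: "has_weak_gradient u G" "G \<in> Lp_loc p" "u \<in> W1p_loc p"
    using C1_in_W1p_loc[OF G cG, of p] p by auto

  \<comment> \<open>\<open>g\<close> is minus the divergence of the flux, so the claim reduces to the pointwise bound \<open>f \<le> g\<close>\<close>
  define f where "f x = norm x powr \<gamma> * u x powr q" for x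
  define g where "g x = c * (DIM('a) * profile \<alpha> (- m) x + profile_grad \<alpha> (- m) x \<bullet> x)" for x :: 'a
  have f_nonneg: "f x \<ge> 0" for x by (simp add: f_def)
  have f_le_g: "f x \<le> g x" for x
  proof -
    have "f x \<le> \<epsilon> powr q * profile \<alpha> (- m) x"
      unfolding f_def u_def using \<alpha> \<gamma> \<epsilon> e p
      by (intro weighted_profile_le) (auto simp: \<alpha>_def m_def)
    also have "\<dots> = c * (\<delta> * profile \<alpha> (- m) x)" by (simp add: \<epsilon>q)
    also have "\<dots> \<le> g x"
      unfolding g_def \<delta>_def using c divergence_profile_ge[OF \<alpha> m(1), of x]
      by (intro mult_left_mono) auto
    finally show ?thesis .
  qed
  have flux: "norm (G x) powr (p - 2) *\<^sub>R G x = (- c) *\<^sub>R (profile \<alpha> (- m) x *\<^sub>R x)" for x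
    using p_flux_profile_grad[OF p(1) \<alpha>_def s(1) \<epsilon>, of x] by (simp add: G_def c_def m_def)

  have "integrable lebesgue (\<lambda>x. f x * \<phi> x) \<and>
      (\<integral>x. (norm (G x) powr (p - 2) *\<^sub>R G x) \<bullet> grad \<phi> x \<partial>lebesgue) \<ge> (\<integral>x. f x * \<phi> x \<partial>lebesgue)"
    if \<phi>: "\<phi> \<in> Cc_infinity" and pos: "\<forall>x. \<phi> x \<ge> 0" for \<phi>
  proof -
    note parts = radial_flux_by_parts[OF GDERIV_profile[OF \<alpha>, of "- m"]
        continuous_on_profile_grad[OF \<alpha>] \<phi>]
    have int_g: "integrable lebesgue (\<lambda>x. g x * \<phi> x)"
      using integrable_mult_right[OF parts(2), of c] by (simp add: g_def mult.assoc)
    have [measurable]: "u \<in> borel_measurable borel" "\<phi> \<in> borel_measurable borel"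
      using cu GDERIV_continuous_on[OF GDERIV_grad[OF \<phi>]]
      by (auto intro: borel_measurable_continuous_onI)
    \<comment> \<open>\<open>f\<close> need not be continuous (for \<open>\<gamma> = 0\<close> the weight jumps at the origin, as \<open>0 powr 0 = 0\<close>),
      so integrability comes from domination by \<open>g * \<phi>\<close>\<close>
    have "(\<lambda>x. f x * \<phi> x) \<in> borel_measurable lebesgue"
      unfolding f_def by (intro measurable_completion) simp
    then have int_f: "integrable lebesgue (\<lambda>x. f x * \<phi> x)"
    proof (rule Bochner_Integration.integrable_bound[OF int_g])
      show "AE x in lebesgue. norm (f x * \<phi> x) \<le> norm (g x * \<phi> x)"
        using f_nonneg f_le_g pos
        by (intro always_eventually) (auto simp: abs_mult intro!: mult_right_mono order_trans[OF f_le_g])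
    qed
    have "(\<integral>x. f x * \<phi> x \<partial>lebesgue) \<le> (\<integral>x. g x * \<phi> x \<partial>lebesgue)"
      using int_f int_g f_le_g pos by (intro integral_mono mult_right_mono) auto
    also have "\<dots> = (\<integral>x. (norm (G x) powr (p - 2) *\<^sub>R G x) \<bullet> grad \<phi> x \<partial>lebesgue)"
      using parts(1) unfolding flux by (simp add: g_def mult.assoc)
    finally show ?thesis using int_f by blast
  qed
  then have "p_laplace_weak_supersolution p f u"
    unfolding p_laplace_weak_supersolution_def using W by blast
  moreover have "u x > 0" for x
    using \<epsilon> by (simp add: u_def profile_pos)
  ultimately show ?thesis
    using W cu unfolding f_def by blast
qed

theorem mainTheorem2:
  fixes p q \<gamma> :: real
  assumes "CARD('n::finite) \<ge> 2"
    and "1 < p" and "p < real CARD('n)"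
    and "\<gamma> \<ge> 0"
    and "q > (real CARD('n) + \<gamma>) * (p - 1) / (real CARD('n) - p)"
  shows "\<exists>u :: real ^ 'n \<Rightarrow> real.
    (\<forall>x. u x \<ge> 0) \<and> (\<exists>x. u x \<noteq> 0) \<and>
    u \<in> W1p_loc p \<and> continuous_on UNIV u \<and>
    p_laplace_weak_supersolution p (\<lambda>x. norm x powr \<gamma> * u x powr q) u"
proof -
  obtain u :: "real ^ 'n \<Rightarrow> real" where u: "\<forall>x. u x > 0"
    "u \<in> W1p_loc p \<and> continuous_on UNIV u \<and>
     p_laplace_weak_supersolution p (\<lambda>x. norm x powr \<gamma> * u x powr q) u"
    using supersolution_exists[where 'a = "real ^ 'n", of p \<gamma> q] assms by auto
  have "(\<forall>x. u x \<ge> 0) \<and> (\<exists>x. u x \<noteq> 0)"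
    using u(1) less_imp_le less_irrefl by metis
  with u(2) show ?thesis by blast
qed

end
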